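(* Let $C_3=E_{12'3'}+E_{23'1'}+E_{31'2'}$ and let $$D_3=\mathcal F''(e_1^* )+\mathcal F''(e_2^* )+\mathcal F''(e_3^* )=E_{1'23}+E_{2'31}+E_{3'12}$$ be the image of $C_3$ under $\wedge^3\mathcal J$. Then for $X=(x,y)^T\in\mathbb R^{3,3}$, $$X\cdot D_3=EE(x)-(E_>E'-E_<E')(y)\in so(3,0,1),$$ where $so(3,0,1)$ is taken in bivector form. Furthermore, for all $v,u,f,q\in\mathbb R^3$, $$\left(\begin{pmatrix} v \\ u \end{pmatrix}\cdot C_3\right)\cdot\left(\begin{pmatrix} f \\ q \end{pmatrix}\cdot D_3\right)=-f\cdot u-2(q\cdot v).$$
   Context: Let $e_0,e_1,e_2,e_3$ be the standard orthonormal basis of $\mathbb R^4$ with dual basis $e_i^*$, and identify $\mathbb R^3=\mathrm{span}(e_1,e_2,e_3)$. $\mathbb R^{3,3}=\Lambda^2(\mathbb R^4)$ has basis $E_i=e_0\wedge e_i$ ($i=1,2,3$), $E_1'=e_2\wedge e_3$, $E_2'=e_3\wedge e_1$, $E_3'=e_1\wedge e_2$ and symmetric bilinear form $E_i\cdot E_j'=\delta_{ij}$, $E_i\cdot E_j=E_i'\cdot E_j'=0$. $(x,y)^T$ (or the column) denotes $E(x)+E'(y)$ with $E(x)=\sum x_iE_i$, $E'(y)=\sum y_iE_i'$. $\mathcal J$ is the linear map interchanging $E_i$ and $E_i'$, $i=1,2,3$. Multi-indexed $E$'s are wedge products, e.g. $E_{1'23}=E_1'\wedge E_2\wedge E_3$.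 For $x\in\mathbb R^3$: $EE(x)=x_1E_{23}+x_2E_{31}+x_3E_{12}$; $E_<E'(x)=x_1E_{23'}+x_2E_{31'}+x_3E_{12'}$; $E_>E'(x)=x_1E_{32'}+x_2E_{13'}+x_3E_{21'}$. With $I_3=E_{123}$, $J_3=E_{1'2'3'}$, $K_2=E_{11'}+E_{22'}+E_{33'}$, for $n\in\mathbb R^3$, $d\in\mathbb R$: $\mathcal F''(de_0^*+\sum n_ie_i^* )=E'(n)\wedge(E'(n)\cdot I_3)+dE'(n)\wedge K_2+d^2J_3$. Inner products in $\Lambda(\mathbb R^{3,3})$: for a vector $a$, $a\cdot(b_1\wedge\cdots\wedge b_r)=\sum_i(-1)^{i-1}(a\cdot b_i)\,b_1\wedge\cdots\widehat{b_i}\cdots\wedge b_r$; for bivectors, $(a\wedge b)\cdot(c\wedge d)=(b\cdot c)(a\cdot d)-(a\cdot c)(b\cdot d)$. $so(3,0,1)$ is the Lie algebra of matrices $\begin{pmatrix} 0 & x^T \\ 0 & [y]_\times \end{pmatrix}\in sl(4)$, $x,y\in\mathbb R^3$ ($[y]_\times p=y\times p$), i.e. the Lie algebra of the special orthogonal group of the quadratic form $\mathrm{diag}(0,1,1,1)$. The bivector form of $M\in sl(4)$ is the unique bivector $B\in\Lambda^2(\mathbb R^{3,3})$ whose Clifford commutator satisfies $B\mathbf X-\mathbf XB=(M\otimes I+I\otimes M)\mathbf X$ for all $\mathbf X\in\Lambda^2(\mathbb R^4)$, where $(M\otimes I+I\otimes M)(a\wedge b)=Ma\wedge b+a\wedge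 Mb$. *)

theory Defs
  imports "HOL-Analysis.Analysis"
begin

section \<open>The space \<open>\<real>\<^sup>3\<^sup>,\<^sup>3 = \<Lambda>\<^sup>2(\<real>\<^sup>4)\<close>\<close>

text \<open>
  \<^term>\<open>Plain i\<close> and \<^term>\<open>Primed i\<close> index the basis vectors \<open>E\<^sub>i\<close> and \<open>E\<^sub>i'\<close>.  The linear order
  \<open>E\<^sub>1, E\<^sub>2, E\<^sub>3, E\<^sub>1', E\<^sub>2', E\<^sub>3'\<close> is only used to normalise basis blades.  (In the type \<^typ>\<open>3\<close> the
  element \<open>3\<close> equals \<open>0\<close>, hence the explicit rank.)
\<close>

datatype ix = Plain 3 | Primed 3

lemma UNIV_ix: "(UNIV :: ix set) = range Plain \<union> range Primed"
  by (auto intro: ix.exhaust)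

instance ix :: finite
  by standard (simp add: UNIV_ix)

definition rank3 :: "3 \<Rightarrow> nat" where
  "rank3 i = (if i = 1 then 0 else if i = 2 then 1 else 2)"

fun ix_rank :: "ix \<Rightarrow> nat" where
  "ix_rank (Plain i) = rank3 i"
| "ix_rank (Primed i) = 3 + rank3 i"

lemma rank3_eq_iff: "rank3 i = rank3 j \<longleftrightarrow> i = j"
  using exhaust_3[of i] exhaust_3[of j] by (auto simp: rank3_def)

lemma rank3_less: "rank3 i < 3"
  by (simp add: rank3_def)

lemma ix_rank_eq_iff: "ix_rank k = ix_rank l \<longleftrightarrow> k = l"
  using rank3_less rank3_eq_iff
  by (cases k; cases l; auto) (metis le_add1 not_less)+

instantiation ix :: linorder
begin

definition less_eq_ix :: "ix \<Rightarrow> ix \<Rightarrow> bool" where "k \<le> l \<longleftrightarrow> ix_rank k \<le> ix_rank l"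
definition less_ix :: "ix \<Rightarrow> ix \<Rightarrow> bool" where "k < l \<longleftrightarrow> ix_rank k < ix_rank l"

instance
  by standard (auto simp: less_eq_ix_def less_ix_def ix_rank_eq_iff)

end

type_synonym R33 = "real^ix"

text \<open>
  The basis vector with index \<open>k\<close> is \<open>e\<^sub>p \<and> e\<^sub>q\<close> with \<open>(p, q) = legs k\<close>, and \<open>wedge4\<close> gives the
  coordinates of \<open>a \<and> b\<close> in this basis.  The standard basis \<open>e\<^sub>0, e\<^sub>1, e\<^sub>2, e\<^sub>3\<close> of \<open>\<real>\<^sup>4\<close> is
  \<open>axis i 1\<close> for \<open>i \<in> {0, 1, 2, 3}\<close> in the type \<^typ>\<open>4\<close>.
\<close>

fun legs :: "ix \<Rightarrow> 4 \<times> 4" where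
  "legs (Plain i) = (0, if i = 1 then 1 else if i = 2 then 2 else 3)"
| "legs (Primed i) = (if i = 1 then (2, 3) else if i = 2 then (3, 1) else (1, 2))"

definition wedge4 :: "real^4 \<Rightarrow> real^4 \<Rightarrow> R33" where
  "wedge4 a b = (\<chi> k. a $ fst (legs k) * b $ snd (legs k) - a $ snd (legs k) * b $ fst (legs k))"

lemma wedge4_basis: "wedge4 (axis (fst (legs k)) 1) (axis (snd (legs k)) 1) = axis k 1"
proof -
  have "wedge4 (axis (fst (legs k)) 1) (axis (snd (legs k)) 1) $ l = axis k 1 $ l" for l
  proof (cases k)
    case (Plain i)
    then show ?thesis
      by (cases l; use exhaust_3[of i] in \<open>auto simp: wedge4_def axis_def split: if_splits\<close>)
        (metis exhaust_3)+
  next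
    case (Primed i)
    then show ?thesis
      by (cases l; use exhaust_3[of i] in \<open>auto simp: wedge4_def axis_def split: if_splits\<close>)
        (metis exhaust_3)+
  qed
  then show ?thesis by (simp add: vec_eq_iff)
qed

definition E :: "real^3 \<Rightarrow> R33" where
  "E x = (\<Sum>i\<in>UNIV. x $ i *\<^sub>R axis (Plain i) 1)"

definition E' :: "real^3 \<Rightarrow> R33" where
  "E' y = (\<Sum>i\<in>UNIV. y $ i *\<^sub>R axis (Primed i) 1)"

definition col :: "real^3 \<Rightarrow> real^3 \<Rightarrow> R33" where
  "col x y = E x + E' y"

definition form :: "R33 \<Rightarrow> R33 \<Rightarrow> real" where
  "form X Y = (\<Sum>i\<in>UNIV. X $ Plain i * Y $ Primed i + X $ Primed i * Y $ Plain i)"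

fun swap_ix :: "ix \<Rightarrow> ix" where
  "swap_ix (Plain i) = Primed i"
| "swap_ix (Primed i) = Plain i"

definition \<J> :: "R33 \<Rightarrow> R33" where
  "\<J> X = (\<chi> k. X $ swap_ix k)"

text \<open>The action \<open>M \<otimes> I + I \<otimes> M\<close> of a matrix on \<open>\<Lambda>\<^sup>2(\<real>\<^sup>4)\<close>.\<close>

definition ext2_action :: "real^4^4 \<Rightarrow> R33 \<Rightarrow> R33" where
  "ext2_action M X = (\<Sum>k\<in>UNIV. X $ k *\<^sub>R
     (wedge4 (M *v axis (fst (legs k)) 1) (axis (snd (legs k)) 1)
      + wedge4 (axis (fst (legs k)) 1) (M *v axis (snd (legs k)) 1)))"

lemma sum_ix: "(\<Sum>k\<in>UNIV. f k) = (\<Sum>i\<in>UNIV. f (Plain i)) + (\<Sum>i\<in>UNIV. f (Primed i))"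
proof -
  have "(\<Sum>k\<in>UNIV. f k) = sum f (range Plain) + sum f (range Primed)"
    unfolding UNIV_ix by (rule sum.union_disjoint) auto
  then show ?thesis by (simp add: sum.reindex inj_on_def)
qed

lemma sum_4': "sum f (UNIV :: 4 set) = f 0 + f 1 + f 2 + f 3"
proof -
  have "(4::4) = 0" by simp
  then have "f 4 = f 0" by (rule arg_cong)
  then show ?thesis unfolding sum_4 by (simp only: ac_simps)
qed

lemma ext2_action_wedge4: "ext2_action M (wedge4 a b) = wedge4 (M *v a) b + wedge4 a (M *v b)"
proof -
  have "ext2_action M (wedge4 a b) $ k = (wedge4 (M *v a) b + wedge4 a (M *v b)) $ k" for k
  proof (cases k)
    case (Plain i)
    then show ?thesis using exhaust_3[of i]
      by (auto simp: ext2_action_def wedge4_def sum_ix sum_3 sum_4' matrix_vector_mult_def axis_def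
          algebra_simps)
  next
    case (Primed i)
    then show ?thesis using exhaust_3[of i]
      by (auto simp: ext2_action_def wedge4_def sum_ix sum_3 sum_4' matrix_vector_mult_def axis_def
          algebra_simps)
  qed
  then show ?thesis by (simp add: vec_eq_iff)
qed


section \<open>The exterior algebra \<open>\<Lambda>(\<real>\<^sup>3\<^sup>,\<^sup>3)\<close>\<close>

text \<open>
  The coefficient at \<open>S\<close> belongs to the wedge product, in increasing order, of the basis vectors
  with index in \<open>S\<close>.
\<close>

type_synonym mv = "real^(ix set)"

definition blade :: "ix set \<Rightarrow> mv" where
  "blade S = axis S 1"

definition vec_mv :: "R33 \<Rightarrow> mv" where
  "vec_mv X = (\<Sum>k\<in>UNIV. X $ k *\<^sub>R blade {k})"

definition shuffle_sign :: "ix set \<Rightarrow> ix set \<Rightarrow> real" where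
  "shuffle_sign S T = (-1) ^ card {(i, j). i \<in> S \<and> j \<in> T \<and> j < i}"

definition wedge :: "mv \<Rightarrow> mv \<Rightarrow> mv" (infixr \<open>\<^bold>\<and>\<close> 75) where
  "A \<^bold>\<and> B = (\<chi> S. \<Sum>T\<in>Pow S. shuffle_sign T (S - T) * A $ T * B $ (S - T))"

text \<open>The inner product \<open>a \<sqdot> (b\<^sub>1 \<and> \<dots> \<and> b\<^sub>r)\<close> of a vector and a multivector, on basis blades.\<close>

definition vdot :: "R33 \<Rightarrow> mv \<Rightarrow> mv" where
  "vdot a A = (\<Sum>S\<in>UNIV. A $ S *\<^sub>R
     (\<Sum>i\<in>S. ((-1) ^ card {j\<in>S. j < i} * form a (axis i 1)) *\<^sub>R blade (S - {i})))"

definition bivector :: "mv \<Rightarrow> bool" where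
  "bivector B \<longleftrightarrow> (\<forall>S. card S \<noteq> 2 \<longrightarrow> B $ S = 0)"

text \<open>The bilinear extension of
  \<open>(a \<and> b) \<sqdot> (c \<and> d) = (b \<sqdot> c) (a \<sqdot> d) - (a \<sqdot> c) (b \<sqdot> d)\<close> to bivectors.\<close>

definition bivdot :: "mv \<Rightarrow> mv \<Rightarrow> real" where
  "bivdot B C = (\<Sum>(i, j)\<in>{(i, j). i < j}. \<Sum>(k, l)\<in>{(k, l). k < l}. B $ {i, j} * C $ {k, l} *
     (form (axis j 1) (axis k 1) * form (axis i 1) (axis l 1)
      - form (axis i 1) (axis k 1) * form (axis j 1) (axis l 1)))"

definition ext_power :: "nat \<Rightarrow> (R33 \<Rightarrow> R33) \<Rightarrow> mv \<Rightarrow> mv" where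
  "ext_power r f A = (\<Sum>S | card S = r. A $ S *\<^sub>R
     foldr (\<lambda>k B. vec_mv (f (axis k 1)) \<^bold>\<and> B) (sorted_list_of_set S) (blade {}))"


section \<open>The Clifford product on \<open>\<Lambda>(\<real>\<^sup>3\<^sup>,\<^sup>3)\<close>\<close>

text \<open>
  The Clifford algebra with \<open>a a = a \<sqdot> a\<close> on the underlying space of the exterior algebra
  (so that \<open>a \<and> b = (a b - b a) / 2\<close> for vectors).  Left multiplication by a vector is
  \<open>a A = a \<sqdot> A + a \<and> A\<close>, and the product with a blade on the left is determined by
  \<open>(a \<and> A) B = a (A B) - (a \<sqdot> A) B\<close>.  A list stands for the wedge product of the basis vectors
  with these indices.
\<close>

definition vmult :: "R33 \<Rightarrow> mv \<Rightarrow> mv" where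
  "vmult a A = vdot a A + vec_mv a \<^bold>\<and> A"

function blade_mult :: "ix list \<Rightarrow> mv \<Rightarrow> mv" where
  "blade_mult [] B = B"
| "blade_mult (k # ks) B = vmult (axis k 1) (blade_mult ks B)
     - (\<Sum>n<length ks. ((-1) ^ n * form (axis k 1) (axis (ks ! n) 1)) *\<^sub>R
          blade_mult (take n ks @ drop (Suc n) ks) B)"
  by pat_completeness auto
termination
  by (relation "Wellfounded.measure (\<lambda>(ks, B). length ks)") auto

definition clifford :: "mv \<Rightarrow> mv \<Rightarrow> mv" (infixl \<open>\<^bold>*\<close> 75) where
  "A \<^bold>* B = (\<Sum>S\<in>UNIV. A $ S *\<^sub>R blade_mult (sorted_list_of_set S) B)"


section \<open>Lie algebras\<close>

definition sl4 :: "(real^4^4) set" where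
  "sl4 = {M. trace M = 0}"

definition bivector_form :: "real^4^4 \<Rightarrow> mv" where
  "bivector_form M = (THE B. bivector B \<and>
     (\<forall>X. B \<^bold>* vec_mv X - vec_mv X \<^bold>* B = vec_mv (ext2_action M X)))"

definition hvec :: "real \<Rightarrow> real^3 \<Rightarrow> real^4" where
  "hvec d p = d *\<^sub>R axis 0 1 + p $ 1 *\<^sub>R axis 1 1 + p $ 2 *\<^sub>R axis 2 1 + p $ 3 *\<^sub>R axis 3 1"

definition spatial :: "real^4 \<Rightarrow> real^3" where
  "spatial p = vector [p $ 1, p $ 2, p $ 3]"

text \<open>The matrix with rows \<open>(0, x\<^sup>T)\<close> and \<open>(0, [y]\<^sub>\<times>)\<close>, given by its action on \<open>\<real>\<^sup>4\<close>.\<close>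

definition so301_matrix :: "real^3 \<Rightarrow> real^3 \<Rightarrow> real^4^4" where
  "so301_matrix x y = matrix (\<lambda>p. hvec (x \<bullet> spatial p) (cross3 y (spatial p)))"

lemma so301_matrix_entries:
  "so301_matrix x y $ 0 $ 0 = 0" "so301_matrix x y $ 0 $ 1 = x $ 1"
  "so301_matrix x y $ 0 $ 2 = x $ 2" "so301_matrix x y $ 0 $ 3 = x $ 3"
  "so301_matrix x y $ 1 $ 0 = 0" "so301_matrix x y $ 1 $ 1 = 0"
  "so301_matrix x y $ 1 $ 2 = - y $ 3" "so301_matrix x y $ 1 $ 3 = y $ 2"
  "so301_matrix x y $ 2 $ 0 = 0" "so301_matrix x y $ 2 $ 1 = y $ 3"
  "so301_matrix x y $ 2 $ 2 = 0" "so301_matrix x y $ 2 $ 3 = - y $ 1"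
  "so301_matrix x y $ 3 $ 0 = 0" "so301_matrix x y $ 3 $ 1 = - y $ 2"
  "so301_matrix x y $ 3 $ 2 = y $ 1" "so301_matrix x y $ 3 $ 3 = 0"
  by (simp_all add: so301_matrix_def matrix_def hvec_def spatial_def cross3_def inner_vec_def
      sum_3 axis_def)

definition so301 :: "(real^4^4) set" where
  "so301 = {M \<in> sl4. \<exists>x y. M = so301_matrix x y}"


section \<open>The multivectors of the statement\<close>

definition Eb :: "3 \<Rightarrow> mv" where
  "Eb i = vec_mv (axis (Plain i) 1)"

definition Eb' :: "3 \<Rightarrow> mv" where
  "Eb' i = vec_mv (axis (Primed i) 1)"

definition EE :: "real^3 \<Rightarrow> mv" where
  "EE x = x $ 1 *\<^sub>R (Eb 2 \<^bold>\<and> Eb 3) + x $ 2 *\<^sub>R (Eb 3 \<^bold>\<and> Eb 1) + x $ 3 *\<^sub>R (Eb 1 \<^bold>\<and> Eb 2)"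

definition ElessE' :: "real^3 \<Rightarrow> mv" where
  "ElessE' x = x $ 1 *\<^sub>R (Eb 2 \<^bold>\<and> Eb' 3) + x $ 2 *\<^sub>R (Eb 3 \<^bold>\<and> Eb' 1) + x $ 3 *\<^sub>R (Eb 1 \<^bold>\<and> Eb' 2)"

definition EgreaterE' :: "real^3 \<Rightarrow> mv" where
  "EgreaterE' x = x $ 1 *\<^sub>R (Eb 3 \<^bold>\<and> Eb' 2) + x $ 2 *\<^sub>R (Eb 1 \<^bold>\<and> Eb' 3) + x $ 3 *\<^sub>R (Eb 2 \<^bold>\<and> Eb' 1)"

definition I\<^sub>3 :: mv where
  "I\<^sub>3 = Eb 1 \<^bold>\<and> Eb 2 \<^bold>\<and> Eb 3"

definition J\<^sub>3 :: mv where
  "J\<^sub>3 = Eb' 1 \<^bold>\<and> Eb' 2 \<^bold>\<and> Eb' 3"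

definition K\<^sub>2 :: mv where
  "K\<^sub>2 = Eb 1 \<^bold>\<and> Eb' 1 + Eb 2 \<^bold>\<and> Eb' 2 + Eb 3 \<^bold>\<and> Eb' 3"

definition dual_e :: "4 \<Rightarrow> real^4 \<Rightarrow> real" where
  "dual_e i p = p $ i"

text \<open>The covector \<open>\<phi> = d e\<^sub>0\<^sup>* + \<Sum> n\<^sub>i e\<^sub>i\<^sup>*\<close> is a linear functional on \<open>\<real>\<^sup>4\<close>, with
  \<open>d = \<phi> e\<^sub>0\<close> and \<open>n\<^sub>i = \<phi> e\<^sub>i\<close>.\<close>

definition \<F>'' :: "(real^4 \<Rightarrow> real) \<Rightarrow> mv" where
  "\<F>'' \<phi> = (let d = \<phi> (axis 0 1);
                n = vector [\<phi> (axis 1 1), \<phi> (axis 2 1), \<phi> (axis 3 1)] :: real^3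
            in vec_mv (E' n) \<^bold>\<and> vdot (E' n) I\<^sub>3 + d *\<^sub>R (vec_mv (E' n) \<^bold>\<and> K\<^sub>2) + d\<^sup>2 *\<^sub>R J\<^sub>3)"

definition C\<^sub>3 :: mv where
  "C\<^sub>3 = Eb 1 \<^bold>\<and> Eb' 2 \<^bold>\<and> Eb' 3 + Eb 2 \<^bold>\<and> Eb' 3 \<^bold>\<and> Eb' 1 + Eb 3 \<^bold>\<and> Eb' 1 \<^bold>\<and> Eb' 2"

definition D\<^sub>3 :: mv where
  "D\<^sub>3 = \<F>'' (dual_e 1) + \<F>'' (dual_e 2) + \<F>'' (dual_e 3)"

end

theory Submission
  imports Defs
begin

text \<open>
  The Clifford commutator of \<open>a \<and> b\<close> with a vector \<open>X\<close> is \<open>2 (b \<sqdot> X) a - 2 (a \<sqdot> X) b\<close>, and since the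
  form is nondegenerate a bivector is determined by these commutators.  Thus every bivector acts on
  \<open>\<real>\<^sup>3\<^sup>,\<^sup>3\<close> as an explicit skew map, and comparing this map with the action of a matrix in \<open>so(3,0,1)\<close>
  shows that \<open>(x, y)\<^sup>T \<sqdot> D\<^sub>3\<close> is the bivector form of the matrix with parameters \<open>2x\<close> and \<open>-2y\<close>.
  The contractions themselves follow from the antiderivation rule
  \<open>a \<sqdot> (b \<and> A) = (a \<sqdot> b) A - b \<and> (a \<sqdot> A)\<close>.
\<close>

section \<open>Exterior product and contraction\<close>

lemma minus_one_power_card_Collect:
  assumes "finite S"
  shows "(-1) ^ card {j\<in>S. P j} = (\<Prod>j\<in>S. if P j then -1 else 1 :: 'a::comm_ring_1)"
proof -
  have "(\<Prod>j\<in>S. if P j then -1 else 1 :: 'a) = (\<Prod>j\<in>{j\<in>S. P j}. -1)"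
    by (rule prod.mono_neutral_cong_right) (use assms in auto)
  then show ?thesis by simp
qed

text \<open>As a double product of local signs, the sign is visibly multiplicative over disjoint
  unions in either argument. The later sign identities are proved in this form.\<close>

lemma shuffle_sign_eq_prod: "shuffle_sign S T = (\<Prod>i\<in>S. \<Prod>j\<in>T. if j < i then -1 else 1)"
proof -
  have "shuffle_sign S T = (-1) ^ card {p \<in> S \<times> T. snd p < fst p}"
    unfolding shuffle_sign_def by (rule arg_cong[where f = "\<lambda>A. (-1) ^ card A"]) auto
  also have "\<dots> = (\<Prod>p\<in>S \<times> T. if snd p < fst p then -1 else 1)"
    by (rule minus_one_power_card_Collect) simp
  also have "\<dots> = (\<Prod>i\<in>S. \<Prod>j\<in>T. if j < i then -1 else 1)"
    by (subst prod.cartesian_product) (simp add: case_prod_beta)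
  finally show ?thesis .
qed

lemma mv_expansion: "A = (\<Sum>S\<in>UNIV. A $ S *\<^sub>R blade S)"
  unfolding blade_def using basis_expansion[of A] by (simp add: scalar_mult_eq_scaleR)

lemma blade_nth: "blade S $ T = (if T = S then 1 else 0)"
  by (simp add: blade_def axis_def)

lemma vec_mv_nth: "vec_mv X $ S = (if is_singleton S then X $ the_elem S else 0)"
proof (cases "is_singleton S")
  case True
  then obtain k where "S = {k}" by (auto elim: is_singletonE)
  then show ?thesis by (simp add: vec_mv_def blade_nth if_distrib cong: if_cong)
next
  case False
  then have "S \<noteq> {k}" for k by auto
  with False show ?thesis by (simp add: vec_mv_def blade_nth)
qed

lemma linear_vec_mv: "linear vec_mv"
  by (rule linearI) (simp_all add: vec_eq_iff vec_mv_nth)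

lemma vec_mv_axis: "vec_mv (axis k 1) = blade {k}"
  by (simp add: vec_mv_def axis_def if_distrib[of "\<lambda>c. c *\<^sub>R _"] cong: if_cong)

lemma bilinear_wedge: "bilinear wedge"
  unfolding bilinear_def
  by (auto intro!: linearI simp: wedge_def vec_eq_iff algebra_simps sum.distrib sum_distrib_left)

text \<open>In the coefficient at \<open>U\<close> only the summand at \<open>S\<close> itself
  survives, and it is nonzero only if \<open>S \<subseteq> U\<close> and
  \<open>U - S = T\<close>.\<close>

lemma wedge_blade:
  "blade S \<^bold>\<and> blade T = (if S \<inter> T = {} then shuffle_sign S T *\<^sub>R blade (S \<union> T) else 0)"
proof -
  have "(blade S \<^bold>\<and> blade T) $ U
      = (if S \<inter> T = {} then shuffle_sign S T *\<^sub>R blade (S \<union> T) else 0) $ U" for U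
  proof -
    have "(blade S \<^bold>\<and> blade T) $ U
        = (\<Sum>V\<in>Pow U. if V = S then shuffle_sign S (U - S) * (if U - S = T then 1 else 0) else 0)"
      unfolding wedge_def vec_lambda_beta by (rule sum.cong) (auto simp: blade_nth)
    also have "\<dots> = (if S \<subseteq> U \<and> U - S = T then shuffle_sign S T else 0)"
      by (subst sum.delta) auto
    also have "S \<subseteq> U \<and> U - S = T \<longleftrightarrow> S \<inter> T = {} \<and> U = S \<union> T" by auto
    finally show ?thesis by (auto simp: blade_nth)
  qed
  then show ?thesis by (simp add: vec_eq_iff)
qed

text \<open>Multilinear identities are reduced to basis vectors by applying this to one argument at
  a time.\<close>

lemma linear_eq_axis:
  fixes f g :: "real^'n::finite \<Rightarrow> 'b::real_vector"
  assumes "linear f" "linear g" "\<And>k. f (axis k 1) = g (axis k 1)"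
  shows "f X = g X"
proof -
  have "f b = g b" if "b \<in> Basis" for b
    using that assms(3) by (auto simp: Basis_vec_def)
  then show ?thesis
    using linear_eq_on_span[OF assms(1,2), of Basis] by (simp add: span_Basis)
qed

lemma linear_eq_blade:
  assumes "linear f" "linear g" "\<And>S. f (blade S) = g (blade S)"
  shows "f A = g A"
  using assms unfolding blade_def by (rule linear_eq_axis)

lemma wedge_add_left: "(A + B) \<^bold>\<and> C = A \<^bold>\<and> C + B \<^bold>\<and> C"
  and wedge_add_right: "A \<^bold>\<and> (B + C) = A \<^bold>\<and> B + A \<^bold>\<and> C"
  and wedge_scaleR_left: "(c *\<^sub>R A) \<^bold>\<and> B = c *\<^sub>R (A \<^bold>\<and> B)"
  and wedge_scaleR_right: "A \<^bold>\<and> (c *\<^sub>R B) = c *\<^sub>R (A \<^bold>\<and> B)"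
  and wedge_minus_left: "(- A) \<^bold>\<and> B = - (A \<^bold>\<and> B)"
  and wedge_minus_right: "A \<^bold>\<and> (- B) = - (A \<^bold>\<and> B)"
  and wedge_diff_left: "(A - B) \<^bold>\<and> C = A \<^bold>\<and> C - B \<^bold>\<and> C"
  and wedge_diff_right: "A \<^bold>\<and> (B - C) = A \<^bold>\<and> B - A \<^bold>\<and> C"
  and wedge_zero_left: "0 \<^bold>\<and> A = 0"
  and wedge_zero_right: "A \<^bold>\<and> 0 = 0"
  and wedge_sum_right: "A \<^bold>\<and> sum F I = (\<Sum>i\<in>I. A \<^bold>\<and> F i)"
  using bilinear_wedge
  by (simp_all add: bilinear_ladd bilinear_radd bilinear_lmul bilinear_rmul bilinear_lneg
      bilinear_rneg bilinear_lsub bilinear_rsub bilinear_lzero bilinear_rzero)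
    (simp add: bilinear_def linear_sum)

lemmas wedge_simps = wedge_add_left wedge_add_right wedge_scaleR_left wedge_scaleR_right
  wedge_minus_left wedge_minus_right wedge_diff_left wedge_diff_right wedge_zero_left
  wedge_zero_right

lemma wedge_assoc: "(A \<^bold>\<and> B) \<^bold>\<and> C = A \<^bold>\<and> B \<^bold>\<and> C"
proof -
  have blades: "(blade S \<^bold>\<and> blade T) \<^bold>\<and> blade U = blade S \<^bold>\<and> blade T \<^bold>\<and> blade U" for S T U
  proof (cases "S \<inter> T = {} \<and> S \<inter> U = {} \<and> T \<inter> U = {}")
    case True
    \<comment> \<open>Both sides are the product of the three pairwise signs of \<open>S\<close>,
      \<open>T\<close> and \<open>U\<close>.\<close>
    then have "shuffle_sign S T * shuffle_sign (S \<union> T) U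
        = shuffle_sign T U * shuffle_sign S (T \<union> U)"
      by (simp add: shuffle_sign_eq_prod prod.union_disjoint prod.distrib)
    with True show ?thesis
      by (simp add: wedge_blade wedge_simps Int_Un_distrib Int_Un_distrib2 Un_assoc)
  qed (auto simp: wedge_blade wedge_simps Int_Un_distrib Int_Un_distrib2)
  \<comment> \<open>The identity on blades is extended linearly in the last argument, then the
    middle one, then the first.\<close>
  have blades2: "(blade S \<^bold>\<and> blade T) \<^bold>\<and> C = blade S \<^bold>\<and> blade T \<^bold>\<and> C" for S T
    by (rule linear_eq_blade[of _ _ C]) (auto intro!: linearI simp: wedge_simps blades)
  have blades1: "(blade S \<^bold>\<and> B) \<^bold>\<and> C = blade S \<^bold>\<and> B \<^bold>\<and> C" for S
    by (rule linear_eq_blade[of _ _ B]) (auto intro!: linearI simp: wedge_simps blades2)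
  show ?thesis
    by (rule linear_eq_blade[of _ _ A]) (auto intro!: linearI simp: wedge_simps blades1)
qed

lemma shuffle_sign_singleton: "shuffle_sign {k} S = (-1) ^ card {j\<in>S. j < k}"
  by (simp add: shuffle_sign_eq_prod minus_one_power_card_Collect)

lemma vec_mv_add: "vec_mv (X + Y) = vec_mv X + vec_mv Y"
  and vec_mv_scaleR: "vec_mv (c *\<^sub>R X) = c *\<^sub>R vec_mv X"
  and vec_mv_minus: "vec_mv (- X) = - vec_mv X"
  and vec_mv_diff: "vec_mv (X - Y) = vec_mv X - vec_mv Y"
  and vec_mv_zero: "vec_mv 0 = 0"
  using linear_vec_mv by (simp_all add: linear_add linear_scale linear_neg linear_diff linear_0)

lemmas vec_mv_simps = vec_mv_add vec_mv_scaleR vec_mv_minus vec_mv_diff vec_mv_zero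

lemma wedge_vec_mv_anticommute: "vec_mv a \<^bold>\<and> vec_mv b = - (vec_mv b \<^bold>\<and> vec_mv a)"
proof -
  have axes: "vec_mv (axis k 1) \<^bold>\<and> vec_mv (axis l 1) = - (vec_mv (axis l 1) \<^bold>\<and> vec_mv (axis k 1))" for k l
    by (cases k l rule: linorder_cases)
      (auto simp: vec_mv_axis wedge_blade shuffle_sign_eq_prod insert_commute)
  have axis: "vec_mv (axis k 1) \<^bold>\<and> vec_mv b = - (vec_mv b \<^bold>\<and> vec_mv (axis k 1))" for k
    by (rule linear_eq_axis[of _ _ b], (auto intro!: linearI simp: wedge_simps vec_mv_simps)[2])
      (rule axes)
  show ?thesis
    by (rule linear_eq_axis[of _ _ a], (auto intro!: linearI simp: wedge_simps vec_mv_simps)[2])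
      (rule axis)
qed

lemma wedge_vec_mv_same: "vec_mv a \<^bold>\<and> vec_mv a = 0"
  using wedge_vec_mv_anticommute[of a a] by (simp add: vec_eq_iff)

section \<open>The bilinear form and contraction by a vector\<close>

lemma bilinear_form: "bilinear form"
  unfolding bilinear_def
  by (auto intro!: linearI simp: form_def algebra_simps sum.distrib sum_distrib_left)

lemma form_add_left: "form (X + Y) Z = form X Z + form Y Z"
  and form_add_right: "form X (Y + Z) = form X Y + form X Z"
  and form_scaleR_left: "form (c *\<^sub>R X) Y = c * form X Y"
  and form_scaleR_right: "form X (c *\<^sub>R Y) = c * form X Y"
  using bilinear_form
  by (simp_all add: bilinear_ladd bilinear_radd bilinear_lmul bilinear_rmul)

lemmas form_simps = form_add_left form_add_right form_scaleR_left form_scaleR_right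

lemma form_commute: "form X Y = form Y X"
  by (simp add: form_def algebra_simps)

lemma form_axis_right: "form X (axis k 1) = X $ swap_ix k"
  by (cases k) (simp_all add: form_def axis_def if_distrib[of "\<lambda>c. _ * c"] cong: if_cong)

text \<open>The contraction sign at \<open>i\<close> is the sign of wedging \<open>blade {i}\<close>
  onto \<open>blade S\<close>, so contraction and wedge share one sign calculus.\<close>

lemma vdot_blade:
  "vdot a (blade S) = (\<Sum>i\<in>S. (shuffle_sign {i} S * form a (axis i 1)) *\<^sub>R blade (S - {i}))"
proof -
  have "vdot a (blade S) = (\<Sum>T\<in>UNIV. if T = S
      then (\<Sum>i\<in>S. (shuffle_sign {i} S * form a (axis i 1)) *\<^sub>R blade (S - {i})) else 0)"
    unfolding vdot_def by (rule sum.cong) (auto simp: blade_nth shuffle_sign_singleton)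
  then show ?thesis by simp
qed

lemma bilinear_vdot: "bilinear vdot"
  unfolding bilinear_def
  by (auto intro!: linearI simp: vdot_def form_simps vec_eq_iff algebra_simps sum.distrib
      sum_distrib_left)

lemma vdot_add_left: "vdot (a + b) A = vdot a A + vdot b A"
  and vdot_add_right: "vdot a (A + B) = vdot a A + vdot a B"
  and vdot_scaleR_left: "vdot (c *\<^sub>R a) A = c *\<^sub>R vdot a A"
  and vdot_scaleR_right: "vdot a (c *\<^sub>R A) = c *\<^sub>R vdot a A"
  and vdot_minus_right: "vdot a (- A) = - vdot a A"
  and vdot_diff_right: "vdot a (A - B) = vdot a A - vdot a B"
  and vdot_zero_right: "vdot a 0 = 0"
  using bilinear_vdot
  by (simp_all add: bilinear_ladd bilinear_radd bilinear_lmul bilinear_rmul bilinear_rneg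
      bilinear_rsub bilinear_rzero)

lemmas vdot_simps = vdot_add_left vdot_add_right vdot_scaleR_left vdot_scaleR_right
  vdot_minus_right vdot_diff_right vdot_zero_right

text \<open>The antiderivation rule, checked on blades. If \<open>k \<in> S\<close>, the wedge
  vanishes and the two terms on the right cancel, because removing \<open>k\<close> and restoring it
  costs the same sign twice. If \<open>k \<notin> S\<close>, contracting \<open>k\<close> itself
  gives the first term, and contracting any other index after adding \<open>k\<close> flips the
  sign.\<close>

lemma vdot_wedge:
  "vdot a (vec_mv b \<^bold>\<and> A) = form a b *\<^sub>R A - vec_mv b \<^bold>\<and> vdot a A"
proof -
  have blades: "vdot a (blade {k} \<^bold>\<and> blade S)
      = form a (axis k 1) *\<^sub>R blade S - blade {k} \<^bold>\<and> vdot a (blade S)" for k S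
  proof (cases "k \<in> S")
    case True
    have "blade {k} \<^bold>\<and> vdot a (blade S)
        = (\<Sum>i\<in>S. if i = k then form a (axis k 1) *\<^sub>R blade S else 0)"
      unfolding vdot_blade wedge_sum_right
    proof (rule sum.cong)
      fix i assume "i \<in> S"
      \<comment> \<open>The factor at \<open>j = k\<close> is 1, since the comparison is strict;
        every other factor occurs twice.\<close>
      have "shuffle_sign {k} S * shuffle_sign {k} (S - {k}) = 1"
        using True
        by (auto simp: shuffle_sign_eq_prod prod.remove[of S k] prod.distrib[symmetric]
            intro!: prod.neutral split: if_splits)
      then show "blade {k} \<^bold>\<and> (shuffle_sign {i} S * form a (axis i 1)) *\<^sub>R blade (S - {i})
          = (if i = k then form a (axis k 1) *\<^sub>R blade S else 0)"
        using True by (auto simp: wedge_simps wedge_blade insert_absorb mult_ac)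
    qed simp
    with True show ?thesis by (simp add: wedge_blade vdot_simps)
  next
    case False
    have sq: "shuffle_sign {k} S * shuffle_sign {k} S = 1"
      by (auto simp: shuffle_sign_eq_prod prod.distrib[symmetric] intro!: prod.neutral)
    have sq': "shuffle_sign {k} (insert k S) = shuffle_sign {k} S"
      using False by (simp add: shuffle_sign_eq_prod)
    have "shuffle_sign {k} S *\<^sub>R
          ((shuffle_sign {i} (insert k S) * form a (axis i 1)) *\<^sub>R blade (insert k S - {i}))
        = - (blade {k} \<^bold>\<and> (shuffle_sign {i} S * form a (axis i 1)) *\<^sub>R blade (S - {i}))"
      if "i \<in> S" for i
    proof -
      have "i \<noteq> k" using that False by auto
      have 1: "shuffle_sign {k} S = (if i < k then -1 else 1) * shuffle_sign {k} (S - {i})"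
        using that by (simp add: shuffle_sign_eq_prod prod.remove[of S i])
      have 2: "shuffle_sign {i} (insert k S) = (if k < i then -1 else 1) * shuffle_sign {i} S"
        using False by (simp add: shuffle_sign_eq_prod)
      have "shuffle_sign {k} S * (shuffle_sign {i} (insert k S) * form a (axis i 1))
          = ((if i < k then -1 else 1) * (if k < i then -1 else 1))
            * (shuffle_sign {i} S * form a (axis i 1) * shuffle_sign {k} (S - {i}))"
        unfolding 1 2 by (simp only: mult_ac)
      \<comment> \<open>Exactly one of \<open>i < k\<close> and \<open>k < i\<close> holds; this is
        the source of the minus sign in the rule.\<close>
      also have "(if i < k then -1 else 1) * (if k < i then -1 else 1) = (-1 :: real)"
        using \<open>i \<noteq> k\<close> by auto
      finally have "shuffle_sign {k} S * (shuffle_sign {i} (insert k S) * form a (axis i 1))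
          = - (shuffle_sign {i} S * form a (axis i 1) * shuffle_sign {k} (S - {i}))"
        by simp
      moreover have "blade {k} \<^bold>\<and> blade (S - {i})
          = shuffle_sign {k} (S - {i}) *\<^sub>R blade (insert k S - {i})"
        using \<open>i \<noteq> k\<close> False by (simp add: wedge_blade insert_Diff_if)
      ultimately show ?thesis
        by (simp only: wedge_scaleR_right scaleR_scaleR scaleR_minus_left)
    qed
    \<comment> \<open>The contraction over \<open>insert k S\<close> splits into the index
      \<open>k\<close>, whose two signs multiply to 1, and the indices in \<open>S\<close> treated
      above.\<close>
    then have "shuffle_sign {k} S *\<^sub>R vdot a (blade (insert k S))
        = form a (axis k 1) *\<^sub>R blade S - blade {k} \<^bold>\<and> vdot a (blade S)"
      using False sq sq'
      by (simp add: vdot_blade wedge_sum_right scaleR_right_distrib scaleR_sum_right sum_negf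
          mult.assoc[symmetric])
    with False show ?thesis by (simp add: wedge_blade vdot_simps)
  qed
  have axes: "vdot a (blade {k} \<^bold>\<and> A) = form a (axis k 1) *\<^sub>R A - blade {k} \<^bold>\<and> vdot a A" for k
    by (rule linear_eq_blade[of _ _ A])
      (auto intro!: linearI simp: wedge_simps vdot_simps blades algebra_simps)
  show ?thesis
    by (rule linear_eq_axis[of _ _ b])
      (auto intro!: linearI
        simp: axes wedge_simps vdot_simps vec_mv_simps form_simps vec_mv_axis algebra_simps)
qed

text \<open>\<open>blade {}\<close> is the scalar 1 of the exterior algebra.\<close>

lemma wedge_scalar: "A \<^bold>\<and> blade {} = A"
  by (rule linear_eq_blade[of _ _ A])
    (auto intro!: linearI simp: wedge_simps wedge_blade shuffle_sign_eq_prod)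

lemma vdot_scalar: "vdot a (blade {}) = 0"
  by (simp add: vdot_blade)

lemma vdot_vec_mv: "vdot a (vec_mv b) = form a b *\<^sub>R blade {}"
  using vdot_wedge[of a b "blade {}"] by (simp add: wedge_scalar vdot_scalar wedge_simps)

lemma vdot_wedge_vec_mv:
  "vdot a (vec_mv b \<^bold>\<and> vec_mv c) = form a b *\<^sub>R vec_mv c - form a c *\<^sub>R vec_mv b"
  by (simp add: vdot_wedge vdot_vec_mv wedge_simps wedge_scalar)

section \<open>Commutators with bivectors\<close>

lemma vmult_add_left: "vmult (a + b) A = vmult a A + vmult b A"
  and vmult_add_right: "vmult a (A + B) = vmult a A + vmult a B"
  and vmult_scaleR_left: "vmult (c *\<^sub>R a) A = c *\<^sub>R vmult a A"
  and vmult_scaleR_right: "vmult a (c *\<^sub>R A) = c *\<^sub>R vmult a A"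
  by (simp_all add: vmult_def vdot_simps wedge_simps vec_mv_simps algebra_simps)

lemmas vmult_simps = vmult_add_left vmult_add_right vmult_scaleR_left vmult_scaleR_right

lemma clifford_add_left: "(A + B) \<^bold>* C = A \<^bold>* C + B \<^bold>* C"
  and clifford_scaleR_left: "(c *\<^sub>R A) \<^bold>* B = c *\<^sub>R (A \<^bold>* B)"
  by (simp_all add: clifford_def algebra_simps sum.distrib scaleR_sum_right)

lemma clifford_minus_left: "(- A) \<^bold>* B = - (A \<^bold>* B)"
  using clifford_scaleR_left[of "-1" A B] by simp

lemma clifford_diff_left: "(A - B) \<^bold>* C = A \<^bold>* C - B \<^bold>* C"
  using clifford_add_left[of A "- B" C] by (simp add: clifford_minus_left)

lemma clifford_zero_left: "0 \<^bold>* A = 0"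
  using clifford_scaleR_left[of 0 0 A] by simp

lemmas clifford_simps = clifford_add_left clifford_scaleR_left clifford_minus_left
  clifford_diff_left clifford_zero_left

lemma clifford_blade: "blade S \<^bold>* B = blade_mult (sorted_list_of_set S) B"
proof -
  have "blade S \<^bold>* B = (\<Sum>T\<in>UNIV. if T = S then blade_mult (sorted_list_of_set S) B else 0)"
    unfolding clifford_def by (rule sum.cong) (auto simp: blade_nth)
  then show ?thesis by simp
qed

lemma clifford_vec_mv: "vec_mv a \<^bold>* B = vmult a B"
  by (rule linear_eq_axis[of _ _ a])
    (auto intro!: linearI
      simp: vec_mv_simps clifford_simps vmult_simps vec_mv_axis clifford_blade)

text \<open>A cyclic permutation of three vectors is a product of two transpositions, so the signs
  cancel.\<close>

lemma wedge_vec_mv_rotate: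
  "vec_mv a \<^bold>\<and> vec_mv b \<^bold>\<and> vec_mv c = vec_mv c \<^bold>\<and> vec_mv a \<^bold>\<and> vec_mv b"
  by (metis wedge_assoc wedge_vec_mv_anticommute wedge_minus_left wedge_minus_right)

text \<open>The left side of the condition that characterises \<open>bivector_form\<close>, isolated
  because it is linear in \<open>B\<close>.\<close>

definition commutator :: "mv \<Rightarrow> R33 \<Rightarrow> mv" where
  "commutator B X = B \<^bold>* vec_mv X - vec_mv X \<^bold>* B"

lemma commutator_add: "commutator (A + B) X = commutator A X + commutator B X"
  and commutator_scaleR: "commutator (c *\<^sub>R A) X = c *\<^sub>R commutator A X"
  by (simp_all add: commutator_def clifford_simps clifford_vec_mv vmult_simps algebra_simps)

lemma linear_commutator: "linear (\<lambda>B. commutator B X)"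
  by (rule linearI) (simp_all add: commutator_add commutator_scaleR)

lemma commutator_minus: "commutator (- A) X = - commutator A X"
  and commutator_diff: "commutator (A - B) X = commutator A X - commutator B X"
  and commutator_zero: "commutator 0 X = 0"
  by (simp_all add: linear_neg[OF linear_commutator] linear_diff[OF linear_commutator]
      linear_0[OF linear_commutator])

lemmas commutator_simps = commutator_add commutator_scaleR commutator_minus commutator_diff
  commutator_zero

lemma blade_pair:
  assumes "k < l"
  shows "blade {k, l} = vec_mv (axis k 1) \<^bold>\<and> vec_mv (axis l 1)"
  using assms by (auto simp: vec_mv_axis wedge_blade shuffle_sign_eq_prod insert_commute)

text \<open>The universal property of the exterior square in a form that is easy to check:
  antisymmetry of \<open>g\<close> settles equal and reversed indices, which leaves only the
  increasing pairs.\<close>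

lemma linear_wedge_eqI:
  fixes f :: "mv \<Rightarrow> 'a::real_vector" and g :: "R33 \<Rightarrow> R33 \<Rightarrow> 'a"
  assumes "linear f" "bilinear g" and anti: "\<And>a b. g a b = - g b a"
    and less: "\<And>k l. k < l \<Longrightarrow> f (blade {k, l}) = g (axis k 1) (axis l 1)"
  shows "f (vec_mv a \<^bold>\<and> vec_mv b) = g a b"
proof -
  have same: "g a a = 0" for a
  proof -
    have "2 *\<^sub>R g a a = 0"
      using anti[of a a] by (metis scaleR_2 right_minus)
    then show ?thesis by simp
  qed
  have axes: "f (vec_mv (axis k 1) \<^bold>\<and> vec_mv (axis l 1)) = g (axis k 1) (axis l 1)" for k l
  proof (cases k l rule: linorder_cases)
    case less
    then show ?thesis using assms(4)[OF less] by (simp add: blade_pair)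
  next
    case equal
    then show ?thesis by (simp add: wedge_vec_mv_same same linear_0[OF assms(1)])
  next
    case greater
    then have "f (- (vec_mv (axis l 1) \<^bold>\<and> vec_mv (axis k 1))) = - g (axis l 1) (axis k 1)"
      using assms(4)[OF greater] by (simp add: blade_pair linear_neg[OF assms(1)])
    then show ?thesis
      by (metis wedge_vec_mv_anticommute anti)
  qed
  have "bilinear (\<lambda>a b. f (vec_mv a \<^bold>\<and> vec_mv b))"
    unfolding bilinear_def using assms(1)
    by (auto intro!: linearI simp: vec_mv_simps wedge_simps linear_add linear_scale)
  then show ?thesis
    using assms(2)
    by (rule bilinear_eq_stdbasis[THEN fun_cong, THEN fun_cong])
      (auto simp: Basis_vec_def axes)
qed

text \<open>The trivector parts of the two products coincide and cancel, while the vector parts are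
  opposite and add up; hence the factor 2.\<close>

lemma commutator_wedge:
  "commutator (vec_mv a \<^bold>\<and> vec_mv b) X = vec_mv ((2 * form b X) *\<^sub>R a - (2 * form a X) *\<^sub>R b)"
proof (rule linear_wedge_eqI[where f = "\<lambda>B. commutator B X"
      and g = "\<lambda>a b. vec_mv ((2 * form b X) *\<^sub>R a - (2 * form a X) *\<^sub>R b)"])
  fix k l :: ix
  assume "k < l"
  let ?a = "axis k 1 :: R33" and ?b = "axis l 1 :: R33"
  have "sorted_list_of_set {k, l} = [k, l]"
    using \<open>k < l\<close> sorted_list_of_set.idem_if_sorted_distinct[of "[k, l]"] by (simp add: less_imp_le)
  \<comment> \<open>The subtracted term is the correction in \<open>blade_mult\<close> that passes
    from the Clifford product of two basis vectors to their wedge.\<close>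
  then have "blade {k, l} \<^bold>* vec_mv X
      = vmult ?a (vmult ?b (vec_mv X)) - form ?a ?b *\<^sub>R vec_mv X"
    by (simp add: clifford_blade)
  also have "\<dots> = form ?b X *\<^sub>R vec_mv ?a - form ?a X *\<^sub>R vec_mv ?b
      + vec_mv X \<^bold>\<and> vec_mv ?a \<^bold>\<and> vec_mv ?b"
    by (simp add: vmult_def vdot_vec_mv vdot_wedge_vec_mv vdot_simps vdot_scalar wedge_simps
        wedge_scalar wedge_vec_mv_rotate[of ?a ?b X])
  finally have 1: "blade {k, l} \<^bold>* vec_mv X = \<dots>" .
  have 2: "vec_mv X \<^bold>* blade {k, l} = form ?a X *\<^sub>R vec_mv ?b - form ?b X *\<^sub>R vec_mv ?a
      + vec_mv X \<^bold>\<and> vec_mv ?a \<^bold>\<and> vec_mv ?b"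
    using \<open>k < l\<close>
    by (simp add: blade_pair clifford_vec_mv vmult_def vdot_wedge_vec_mv form_commute[of X])
  have double: "(2 * c) *\<^sub>R v = c *\<^sub>R v + c *\<^sub>R v" for c :: real and v :: mv
    by (simp flip: scaleR_add_left)
  show "commutator (blade {k, l}) X = vec_mv ((2 * form ?b X) *\<^sub>R ?a - (2 * form ?a X) *\<^sub>R ?b)"
    unfolding commutator_def 1 2 vec_mv_simps double by (simp only: algebra_simps)
next
  show "bilinear (\<lambda>a b. vec_mv ((2 * form b X) *\<^sub>R a - (2 * form a X) *\<^sub>R b))"
    unfolding bilinear_def by (auto intro!: linearI simp: vec_mv_simps form_simps algebra_simps)
qed (simp_all add: linear_commutator vec_mv_simps)

section \<open>Recovering a bivector from its commutators\<close>

lemma card_2_ix: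
  fixes S :: "ix set"
  assumes "card S = 2"
  obtains k l where "k < l" "S = {k, l}"
proof -
  obtain a b where ab: "S = {a, b}" "a \<noteq> b" using assms by (auto simp: card_2_iff)
  show thesis
    by (rule that[of "min a b" "max a b"]) (use ab in \<open>auto simp: min_def max_def\<close>)
qed

lemma swap_ix_swap_ix [simp]: "swap_ix (swap_ix k) = k"
  by (cases k) auto

lemma form_axis_axis: "form (axis k 1) (axis l 1) = (if k = swap_ix l then 1 else 0)"
  unfolding form_axis_right by (auto simp: axis_def)

lemma commutator_expansion: "commutator B X = (\<Sum>S\<in>UNIV. B $ S *\<^sub>R commutator (blade S) X)"
proof -
  have "commutator (\<Sum>S\<in>UNIV. B $ S *\<^sub>R blade S) X
      = (\<Sum>S\<in>UNIV. B $ S *\<^sub>R commutator (blade S) X)"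
    by (simp only: linear_sum[OF linear_commutator] commutator_scaleR)
  then show ?thesis by (simp only: mv_expansion[of B, symmetric])
qed

lemma axis_nth: "axis i x $ j = (if j = i then x else 0)"
  by (simp add: axis_def)

text \<open>The basis vector at \<open>swap_ix l\<close> pairs only with the one at
  \<open>l\<close>. Its commutator with a blade therefore keeps only the partner of
  \<open>l\<close>, and the component at \<open>k\<close> isolates one coefficient.\<close>

lemma commutator_nth:
  assumes "bivector B" "k < l"
  shows "commutator B (axis (swap_ix l) 1) $ {k} = 2 * B $ {k, l}"
proof -
  have "commutator B (axis (swap_ix l) 1) $ {k}
      = (\<Sum>S\<in>UNIV. B $ S * commutator (blade S) (axis (swap_ix l) 1) $ {k})"
    unfolding commutator_expansion[of B]
    by (simp only: sum_component vector_scaleR_component real_scaleR_def)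
  also have "\<dots> = (\<Sum>S\<in>UNIV. if S = {k, l} then 2 * B $ {k, l} else 0)"
  proof (rule sum.cong)
    fix S :: "ix set"
    show "B $ S * commutator (blade S) (axis (swap_ix l) 1) $ {k}
        = (if S = {k, l} then 2 * B $ {k, l} else 0)"
    proof (cases "card S = 2")
      case True
      then obtain m n where "m < n" "S = {m, n}" by (rule card_2_ix)
      have "commutator (blade S) (axis (swap_ix l) 1) $ {k}
          = 2 * (if n = l then 1 else 0) * (if k = m then 1 else 0)
            - 2 * (if m = l then 1 else 0) * (if k = n then 1 else 0)"
        unfolding \<open>S = {m, n}\<close> blade_pair[OF \<open>m < n\<close>] commutator_wedge vec_mv_nth form_axis_axis
          swap_ix_swap_ix
        by (simp add: axis_nth)
      \<comment> \<open>The second summand would need \<open>m = l\<close> and \<open>k = n\<close>,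
        which contradicts \<open>m < n\<close> and \<open>k < l\<close>.\<close>
      also have "\<dots> = (if S = {k, l} then 2 else 0)"
        using \<open>S = {m, n}\<close> \<open>m < n\<close> \<open>k < l\<close> by (auto simp: doubleton_eq_iff)
      finally show ?thesis by simp
    next
      case False
      then show ?thesis using assms by (auto simp: bivector_def)
    qed
  qed simp
  finally show ?thesis by simp
qed

lemma bivector_eqI:
  assumes "bivector B" "bivector C" "\<And>X. commutator B X = commutator C X"
  shows "B = C"
proof -
  have "B $ S = C $ S" for S
  proof (cases "card S = 2")
    case True
    then obtain k l where "k < l" "S = {k, l}" by (rule card_2_ix)
    then show ?thesis
      using commutator_nth[OF assms(1)] commutator_nth[OF assms(2)] assms(3) by force
  next
    case False
    then show ?thesis using assms by (simp add: bivector_def)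
  qed
  then show ?thesis by (simp add: vec_eq_iff)
qed

text \<open>Uniqueness in the definite description is supplied by \<open>bivector_eqI\<close>, so
  computing a bivector form amounts to verifying a candidate.\<close>

lemma bivector_form_eqI:
  assumes "bivector B" "\<And>X. commutator B X = vec_mv (ext2_action M X)"
  shows "bivector_form M = B"
  unfolding bivector_form_def
proof (rule the_equality)
  show "bivector B \<and> (\<forall>X. B \<^bold>* vec_mv X - vec_mv X \<^bold>* B = vec_mv (ext2_action M X))"
    using assms unfolding commutator_def by blast
next
  fix C
  assume "bivector C \<and> (\<forall>X. C \<^bold>* vec_mv X - vec_mv X \<^bold>* C = vec_mv (ext2_action M X))"
  then have "bivector C" "\<And>X. commutator C X = commutator B X"
    \<comment> \<open>The commutator of \<open>B\<close> is replaced by the action first; only then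
      is the remaining commutator of \<open>C\<close> opened.\<close>
    unfolding assms(2) unfolding commutator_def by blast+
  then show "C = B" using assms(1) by (blast intro: bivector_eqI)
qed

section \<open>Inner product of bivectors\<close>

lemma sum_pairs_blade:
  assumes "k < l"
  shows "(\<Sum>(m, n)\<in>{(m, n). m < n}. blade {k, l} $ {m, n} * f m n) = f k l"
proof -
  have "(\<Sum>(m, n)\<in>{(m, n). m < n}. blade {k, l} $ {m, n} * f m n)
      = (\<Sum>p\<in>{(m, n). m < n}. if p = (k, l) then f k l else 0)"
    using assms by (intro sum.cong) (auto simp: blade_nth doubleton_eq_iff split: if_splits)
  with assms show ?thesis by simp
qed

text \<open>With the coefficient of \<open>B\<close> pulled out of the inner sum,
  \<open>sum_pairs_blade\<close> can collapse the outer and then the inner sum.\<close>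

lemma bivdot_alt:
  "bivdot B C = (\<Sum>(i, j)\<in>{(i, j). i < j}. B $ {i, j} * (\<Sum>(k, l)\<in>{(k, l). k < l}. C $ {k, l} *
     (form (axis j 1) (axis k 1) * form (axis i 1) (axis l 1)
      - form (axis i 1) (axis k 1) * form (axis j 1) (axis l 1))))"
  unfolding bivdot_def sum_distrib_left case_prod_beta mult.assoc ..

lemma bilinear_bivdot: "bilinear bivdot"
  unfolding bilinear_def
  by (auto intro!: linearI
    simp: bivdot_def case_prod_beta distrib_left distrib_right sum.distrib sum_distrib_left mult_ac)

lemma bivdot_wedge:
  "bivdot (vec_mv a \<^bold>\<and> vec_mv b) (vec_mv c \<^bold>\<and> vec_mv d)
    = form b c * form a d - form a c * form b d"
proof -
  \<comment> \<open>The second argument is extended first, against a fixed basis blade; the first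
    argument follows.\<close>
  have 1: "bivdot (blade {i, j}) (vec_mv c \<^bold>\<and> vec_mv d)
      = form (axis j 1) c * form (axis i 1) d - form (axis i 1) c * form (axis j 1) d"
    if "i < j" for i j
  proof (rule linear_wedge_eqI[where f = "bivdot (blade {i, j})"
        and g = "\<lambda>c d. form (axis j 1) c * form (axis i 1) d - form (axis i 1) c * form (axis j 1) d"])
    show "linear (bivdot (blade {i, j}))"
      using bilinear_bivdot by (simp add: bilinear_def)
    show "bilinear (\<lambda>c d. form (axis j 1) c * form (axis i 1) d - form (axis i 1) c * form (axis j 1) d)"
      unfolding bilinear_def by (auto intro!: linearI simp: form_simps algebra_simps)
    show "bivdot (blade {i, j}) (blade {k, l})
        = form (axis j 1) (axis k 1) * form (axis i 1) (axis l 1)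
          - form (axis i 1) (axis k 1) * form (axis j 1) (axis l 1)" if "k < l" for k l
      unfolding bivdot_alt sum_pairs_blade[OF \<open>i < j\<close>] sum_pairs_blade[OF that] ..
  qed simp
  show ?thesis
  proof (rule linear_wedge_eqI[where f = "\<lambda>B. bivdot B (vec_mv c \<^bold>\<and> vec_mv d)"
        and g = "\<lambda>a b. form b c * form a d - form a c * form b d"])
    show "linear (\<lambda>B. bivdot B (vec_mv c \<^bold>\<and> vec_mv d))"
      using bilinear_bivdot by (simp add: bilinear_def)
    show "bilinear (\<lambda>a b. form b c * form a d - form a c * form b d)"
      unfolding bilinear_def by (auto intro!: linearI simp: form_simps algebra_simps)
  qed (simp_all add: 1)
qed

section \<open>The trivectors \<open>C\<^sub>3\<close> and \<open>D\<^sub>3\<close>\<close>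

lemma Eb'_Eb_anticommute: "Eb' i \<^bold>\<and> Eb j = - (Eb j \<^bold>\<and> Eb' i)"
  unfolding Eb_def Eb'_def by (rule wedge_vec_mv_anticommute)

lemma Eb_Eb_anticommute: "Eb i \<^bold>\<and> Eb j = - (Eb j \<^bold>\<and> Eb i)"
  unfolding Eb_def by (rule wedge_vec_mv_anticommute)

lemma Eb'_Eb'_anticommute: "Eb' i \<^bold>\<and> Eb' j = - (Eb' j \<^bold>\<and> Eb' i)"
  unfolding Eb'_def by (rule wedge_vec_mv_anticommute)

lemma col_nth: "col x y $ Plain i = x $ i" "col x y $ Primed i = y $ i"
  by (simp_all add: col_def E_def E'_def axis_nth if_distrib[of "\<lambda>c. _ * c"] cong: if_cong)

lemma vdot_Eb:
  "vdot X (Eb i \<^bold>\<and> A) = X $ Primed i *\<^sub>R A - Eb i \<^bold>\<and> vdot X A"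
  "vdot X (Eb' i \<^bold>\<and> A) = X $ Plain i *\<^sub>R A - Eb' i \<^bold>\<and> vdot X A"
  "vdot X (Eb i) = X $ Primed i *\<^sub>R blade {}"
  "vdot X (Eb' i) = X $ Plain i *\<^sub>R blade {}"
  by (simp_all add: Eb_def Eb'_def vdot_wedge vdot_vec_mv form_axis_right)

text \<open>These covectors have \<open>d = 0\<close>, so only the term with
  \<open>I\<^sub>3\<close> remains, and contracting with \<open>E\<^sub>i'\<close> deletes
  \<open>E\<^sub>i\<close> from it.\<close>

lemma F_dual_e:
  "\<F>'' (dual_e 1) = Eb' 1 \<^bold>\<and> Eb 2 \<^bold>\<and> Eb 3"
  "\<F>'' (dual_e 2) = Eb' 2 \<^bold>\<and> Eb 3 \<^bold>\<and> Eb 1"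
  "\<F>'' (dual_e 3) = Eb' 3 \<^bold>\<and> Eb 1 \<^bold>\<and> Eb 2"
proof -
  have E': "E' (vector [1, 0, 0]) = axis (Primed 1) 1" "E' (vector [0, 1, 0]) = axis (Primed 2) 1"
      "E' (vector [0, 0, 1]) = axis (Primed 3) 1"
    by (simp_all add: E'_def sum_3)
  show "\<F>'' (dual_e 1) = Eb' 1 \<^bold>\<and> Eb 2 \<^bold>\<and> Eb 3" "\<F>'' (dual_e 3) = Eb' 3 \<^bold>\<and> Eb 1 \<^bold>\<and> Eb 2"
    by (simp_all add: \<F>''_def Let_def dual_e_def axis_nth E' I\<^sub>3_def vdot_Eb wedge_simps wedge_scalar
        flip: Eb'_def)
  \<comment> \<open>Deleting the middle factor of \<open>I\<^sub>3\<close> costs a sign, which is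
    absorbed by reversing the remaining two factors.\<close>
  show "\<F>'' (dual_e 2) = Eb' 2 \<^bold>\<and> Eb 3 \<^bold>\<and> Eb 1"
    by (simp add: \<F>''_def Let_def dual_e_def axis_nth E' I\<^sub>3_def vdot_Eb wedge_simps wedge_scalar
        Eb_Eb_anticommute[of 3 1] flip: Eb'_def)
qed

lemma D\<^sub>3_eq:
  "D\<^sub>3 = Eb' 1 \<^bold>\<and> Eb 2 \<^bold>\<and> Eb 3 + Eb' 2 \<^bold>\<and> Eb 3 \<^bold>\<and> Eb 1 + Eb' 3 \<^bold>\<and> Eb 1 \<^bold>\<and> Eb 2"
  by (simp add: D\<^sub>3_def F_dual_e)

section \<open>The image of \<open>C\<^sub>3\<close> under the exterior cube of
  \<open>\<J>\<close>\<close>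

lemma linear_ext_power: "linear (ext_power r f)"
  by (rule linearI) (simp_all add: ext_power_def scaleR_add_left sum.distrib scaleR_sum_right)

lemma ext_power_blade:
  "ext_power (card S) f (blade S)
    = foldr (\<lambda>k B. vec_mv (f (axis k 1)) \<^bold>\<and> B) (sorted_list_of_set S) (blade {})"
proof -
  have "ext_power (card S) f (blade S) = (\<Sum>T | card T = card S. if T = S then
      foldr (\<lambda>k B. vec_mv (f (axis k 1)) \<^bold>\<and> B) (sorted_list_of_set S) (blade {}) else 0)"
    unfolding ext_power_def by (rule sum.cong) (auto simp: blade_nth)
  then show ?thesis by simp
qed

text \<open>For increasing indices the wedge is itself a basis blade, without a sign, so the
  definition of \<open>ext_power\<close> applies directly.\<close>

lemma ext_power_3_wedge:
  assumes "i < j" "j < k"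
  shows "ext_power 3 f (vec_mv (axis i 1) \<^bold>\<and> vec_mv (axis j 1) \<^bold>\<and> vec_mv (axis k 1))
    = vec_mv (f (axis i 1)) \<^bold>\<and> vec_mv (f (axis j 1)) \<^bold>\<and> vec_mv (f (axis k 1))"
proof -
  have "i < k" using assms by (rule less_trans)
  note less = assms this
  have sorted: "sorted [i, j, k]" "distinct [i, j, k]" using less by auto
  have "vec_mv (axis i 1) \<^bold>\<and> vec_mv (axis j 1) \<^bold>\<and> vec_mv (axis k 1) = blade {i, j, k}"
    unfolding blade_pair[OF \<open>j < k\<close>, symmetric] vec_mv_axis[of i] wedge_blade
    using less by (auto simp: shuffle_sign_eq_prod insert_commute)
  moreover have "sorted_list_of_set {i, j, k} = [i, j, k]"
    using sorted_list_of_set.idem_if_sorted_distinct[OF sorted] unfolding list.set .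
  moreover have "card {i, j, k} = 3"
    using distinct_card[OF sorted(2)] unfolding list.set by simp
  ultimately show ?thesis
    using ext_power_blade[of "{i, j, k}" f] by (simp add: wedge_scalar)
qed

lemma \<J>_axis: "\<J> (axis k 1) = axis (swap_ix k) 1"
proof -
  have "swap_ix l = k \<longleftrightarrow> l = swap_ix k" for l by auto
  then show ?thesis by (simp add: \<J>_def vec_eq_iff axis_nth)
qed

lemma ext_power_\<J>_C\<^sub>3: "ext_power 3 \<J> C\<^sub>3 = D\<^sub>3"
proof -
  have less: "Plain 1 < Primed 2" "Primed 2 < Primed 3" "Plain 2 < Primed 1" "Primed 1 < Primed 3"
      "Plain 3 < Primed 1" "Primed 1 < Primed 2"
    by (simp_all add: less_ix_def rank3_def)
  \<comment> \<open>Only the middle summand has its indices out of order; the sign introduced by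
    sorting them is undone at the end by swapping \<open>Eb 3\<close> and
    \<open>Eb 1\<close>.\<close>
  have C: "C\<^sub>3 = Eb 1 \<^bold>\<and> Eb' 2 \<^bold>\<and> Eb' 3 - Eb 2 \<^bold>\<and> Eb' 1 \<^bold>\<and> Eb' 3 + Eb 3 \<^bold>\<and> Eb' 1 \<^bold>\<and> Eb' 2"
    unfolding C\<^sub>3_def Eb'_Eb'_anticommute[of 3 1] by (simp add: wedge_simps)
  have "ext_power 3 \<J> C\<^sub>3
      = Eb' 1 \<^bold>\<and> Eb 2 \<^bold>\<and> Eb 3 - Eb' 2 \<^bold>\<and> Eb 1 \<^bold>\<and> Eb 3 + Eb' 3 \<^bold>\<and> Eb 1 \<^bold>\<and> Eb 2"
    unfolding C linear_add[OF linear_ext_power] linear_diff[OF linear_ext_power]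
    by (simp add: Eb_def Eb'_def ext_power_3_wedge less \<J>_axis)
  then show ?thesis
    unfolding D\<^sub>3_eq Eb_Eb_anticommute[of 3 1] by (simp add: wedge_simps)
qed

text \<open>The primed factor of each summand is paired with \<open>x\<close> and leaves
  \<open>EE x\<close>; the two unprimed factors are paired with \<open>y\<close> and leave mixed
  bivectors.\<close>

lemma vdot_D\<^sub>3: "vdot (col x y) D\<^sub>3 = EE x - (EgreaterE' y - ElessE' y)"
  unfolding D\<^sub>3_eq EE_def EgreaterE'_def ElessE'_def
  by (simp add: vdot_simps vdot_Eb col_nth wedge_simps wedge_scalar Eb'_Eb_anticommute algebra_simps)

lemma vdot_C\<^sub>3:
  "vdot (col v u) C\<^sub>3
    = u $ 1 *\<^sub>R (Eb' 2 \<^bold>\<and> Eb' 3) + u $ 2 *\<^sub>R (Eb' 3 \<^bold>\<and> Eb' 1) + u $ 3 *\<^sub>R (Eb' 1 \<^bold>\<and> Eb' 2)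
    - (EgreaterE' v - ElessE' v)"
  unfolding C\<^sub>3_def EgreaterE'_def ElessE'_def
  by (simp add: vdot_simps vdot_Eb col_nth wedge_simps wedge_scalar algebra_simps)

section \<open>Bivector forms of matrices in so(3,0,1)\<close>

lemma bivector_wedge: "bivector (vec_mv a \<^bold>\<and> vec_mv b)"
  unfolding bivector_def
proof (intro allI impI)
  fix S :: "ix set"
  assume "card S \<noteq> 2"
  have "vec_mv a $ T * vec_mv b $ (S - T) = 0" if "T \<subseteq> S" for T
  proof -
    have "\<not> (is_singleton T \<and> is_singleton (S - T))"
      using \<open>card S \<noteq> 2\<close> that card_Diff_subset[of T S] card_mono[of S T]
      by (auto simp: is_singleton_altdef)
    then show ?thesis by (auto simp: vec_mv_nth)
  qed
  then show "(vec_mv a \<^bold>\<and> vec_mv b) $ S = 0"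
    by (auto simp: wedge_def mult.assoc intro!: sum.neutral)
qed

lemma bivector_lin:
  "bivector A \<Longrightarrow> bivector B \<Longrightarrow> bivector (A + B)"
  "bivector A \<Longrightarrow> bivector B \<Longrightarrow> bivector (A - B)"
  "bivector A \<Longrightarrow> bivector (c *\<^sub>R A)"
  by (simp_all add: bivector_def)

lemma so301_matrix_in_so301: "so301_matrix x y \<in> so301"
  by (auto simp: so301_def sl4_def trace_def sum_4' so301_matrix_entries)

text \<open>Writing \<open>X\<close> as the column of \<open>p\<close> and \<open>p'\<close>, the
  plain half of the image is the cross product of \<open>y\<close> and \<open>p\<close> minus that
  of \<open>x\<close> and \<open>p'\<close>; the primed half is the cross product of
  \<open>y\<close> and \<open>p'\<close>.\<close>

lemma ext2_action_so301_matrix: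
  "ext2_action (so301_matrix x y) X $ Plain 1
    = y $ 2 * X $ Plain 3 - y $ 3 * X $ Plain 2 - x $ 2 * X $ Primed 3 + x $ 3 * X $ Primed 2"
  "ext2_action (so301_matrix x y) X $ Plain 2
    = y $ 3 * X $ Plain 1 - y $ 1 * X $ Plain 3 - x $ 3 * X $ Primed 1 + x $ 1 * X $ Primed 3"
  "ext2_action (so301_matrix x y) X $ Plain 3
    = y $ 1 * X $ Plain 2 - y $ 2 * X $ Plain 1 - x $ 1 * X $ Primed 2 + x $ 2 * X $ Primed 1"
  "ext2_action (so301_matrix x y) X $ Primed 1 = y $ 2 * X $ Primed 3 - y $ 3 * X $ Primed 2"
  "ext2_action (so301_matrix x y) X $ Primed 2 = y $ 3 * X $ Primed 1 - y $ 1 * X $ Primed 3"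
  "ext2_action (so301_matrix x y) X $ Primed 3 = y $ 1 * X $ Primed 2 - y $ 2 * X $ Primed 1"
  by (simp_all add: ext2_action_def wedge4_def sum_ix sum_3 sum_4' matrix_vector_mult_def axis_nth
      so301_matrix_entries algebra_simps)

lemma R33_eq_iff:
  fixes X Y :: R33
  shows "X = Y \<longleftrightarrow> X $ Plain 1 = Y $ Plain 1 \<and> X $ Plain 2 = Y $ Plain 2 \<and> X $ Plain 3 = Y $ Plain 3
    \<and> X $ Primed 1 = Y $ Primed 1 \<and> X $ Primed 2 = Y $ Primed 2 \<and> X $ Primed 3 = Y $ Primed 3"
proof -
  have "X = Y \<longleftrightarrow> (\<forall>i. X $ Plain i = Y $ Plain i) \<and> (\<forall>i. X $ Primed i = Y $ Primed i)"
    unfolding vec_eq_iff by (metis ix.exhaust)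
  then show ?thesis unfolding forall_3 by blast
qed

text \<open>By \<open>commutator_wedge\<close>, \<open>EE x\<close> sends the primed half
  \<open>p'\<close> to -2 times the cross product of \<open>x\<close> and \<open>p'\<close> in the
  plain half, and the mixed part acts on both halves as the cross product with
  \<open>-2 *\<^sub>R y\<close>. This gives the parameters of the matrix.\<close>

lemma bivector_form_so301_matrix:
  "bivector_form (so301_matrix (2 *\<^sub>R x) (- 2 *\<^sub>R y)) = EE x - (EgreaterE' y - ElessE' y)"
proof (rule bivector_form_eqI)
  show "bivector (EE x - (EgreaterE' y - ElessE' y))"
    unfolding EE_def EgreaterE'_def ElessE'_def Eb_def Eb'_def
    by (intro bivector_lin bivector_wedge)
  show "commutator (EE x - (EgreaterE' y - ElessE' y)) X
      = vec_mv (ext2_action (so301_matrix (2 *\<^sub>R x) (- 2 *\<^sub>R y)) X)" for X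
    \<comment> \<open>The reversed rules for \<open>vec_mv\<close> gather the sum into a single
      \<open>vec_mv\<close>, which leaves an equation between six coordinates.\<close>
    unfolding EE_def EgreaterE'_def ElessE'_def Eb_def Eb'_def commutator_simps commutator_wedge
      vec_mv_simps(2,1,4)[symmetric] form_commute[of _ X] form_axis_right
    by (rule arg_cong[where f = vec_mv])
      (simp add: R33_eq_iff axis_nth ext2_action_so301_matrix algebra_simps)
qed

section \<open>The inner product of the two contractions\<close>

lemma bivdot_simps:
  "bivdot (A + B) C = bivdot A C + bivdot B C"
  "bivdot A (B + C) = bivdot A B + bivdot A C"
  "bivdot (A - B) C = bivdot A C - bivdot B C"
  "bivdot A (B - C) = bivdot A B - bivdot A C"
  "bivdot (c *\<^sub>R A) B = c * bivdot A B"
  "bivdot A (c *\<^sub>R B) = c * bivdot A B"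
  using bilinear_bivdot
  by (simp_all add: bilinear_ladd bilinear_radd bilinear_lsub bilinear_rsub bilinear_lmul bilinear_rmul)

text \<open>Each purely primed bivector meets its unprimed counterpart with value -1. Among mixed
  ones only pairs such as \<open>E\<^sub>3 \<and> E\<^sub>2'\<close> and
  \<open>E\<^sub>2 \<and> E\<^sub>3'\<close> meet, with value 1; they enter with opposite signs and
  occur in both orders, which gives the coefficient -2.\<close>

lemma bivdot_vdot_C\<^sub>3_vdot_D\<^sub>3:
  "bivdot (vdot (col v u) C\<^sub>3) (vdot (col f q) D\<^sub>3) = - (f \<bullet> u) - 2 * (q \<bullet> v)"
  unfolding vdot_C\<^sub>3 vdot_D\<^sub>3 EE_def EgreaterE'_def ElessE'_def bivdot_simps Eb_def Eb'_def
    bivdot_wedge form_axis_axis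
  by (simp add: inner_vec_def sum_3 algebra_simps)

theorem proposition39:
  shows "D\<^sub>3 = Eb' 1 \<^bold>\<and> Eb 2 \<^bold>\<and> Eb 3 + Eb' 2 \<^bold>\<and> Eb 3 \<^bold>\<and> Eb 1 + Eb' 3 \<^bold>\<and> Eb 1 \<^bold>\<and> Eb 2
    \<and> D\<^sub>3 = ext_power 3 \<J> C\<^sub>3
    \<and> (\<forall>x y :: real^3.
          vdot (col x y) D\<^sub>3 = EE x - (EgreaterE' y - ElessE' y)
        \<and> vdot (col x y) D\<^sub>3 \<in> bivector_form ` so301)
    \<and> (\<forall>v u f q :: real^3.
          bivdot (vdot (col v u) C\<^sub>3) (vdot (col f q) D\<^sub>3) = - (f \<bullet> u) - 2 * (q \<bullet> v))"
proof (intro conjI allI)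
  show "vdot (col x y) D\<^sub>3 \<in> bivector_form ` so301" for x y
    unfolding vdot_D\<^sub>3 bivector_form_so301_matrix[symmetric]
    by (rule imageI) (rule so301_matrix_in_so301)
qed (fact D\<^sub>3_eq ext_power_\<J>_C\<^sub>3[symmetric] vdot_D\<^sub>3 bivdot_vdot_C\<^sub>3_vdot_D\<^sub>3)+

end
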